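(* Let $n\ge1$. The metric $\tilde G$ on $\tilde P=\mathbb{R}^{2n+2}$ is an indefinite (pseudo-Riemannian) Einstein metric, i.e. its Ricci tensor is a constant multiple of $\tilde G$, of scalar curvature $R(\tilde G)=(n+1)(n+2)$.
   Context: $\tilde P=\mathbb{R}^{2n+2}$ has coordinates $(p_0,\dots,p_n;x^0,\dots,x^n)$. The pseudo-Riemannian metric $\tilde G$ is given in the coordinates $(p,x)$ by the matrix $$\tilde G=\begin{pmatrix}0_{(n+1)\times(n+1)} & I_{n+1} \\ I_{n+1} & (p_ip_j)\end{pmatrix},$$ i.e. $\tilde G=\sum_{i=0}^n(dp_i\otimes dx^i+dx^i\otimes dp_i)+\tilde\theta\otimes\tilde\theta$ with $\tilde\theta=\sum_{i=0}^np_i\,dx^i$. Conventions: with the Christoffel symbols $\Gamma^\alpha_{\beta\gamma}$ of the Levi-Civita connection, the Ricci tensor is $R_{\alpha\beta}=\partial_\mu\Gamma^\mu_{\beta\alpha}-\partial_\beta\Gamma^\mu_{\mu\alpha}+\Gamma^\mu_{\mu\gamma}\Gamma^\gamma_{\beta\alpha}-\Gamma^\mu_{\beta\gamma}\Gamma^\gamma_{\mu\alpha}$, and the scalar curvature is $\tilde G^{\alpha\beta}R_{\alpha\beta}$. *)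

theory Defs imports "HOL-Analysis.Analysis" begin

definition partial_deriv :: "'k::finite \<Rightarrow> (real ^ 'k \<Rightarrow> real) \<Rightarrow> real ^ 'k \<Rightarrow> real" where
  "partial_deriv a f z = deriv (\<lambda>t. f (z + t *\<^sub>R axis a 1)) 0"

fun C_k :: "nat \<Rightarrow> (real ^ 'k::finite \<Rightarrow> real) \<Rightarrow> bool" where
  "C_k 0 f \<longleftrightarrow> continuous_on UNIV f"
| "C_k (Suc k) f \<longleftrightarrow> (\<forall>z. f differentiable (at z)) \<and> (\<forall>a. C_k k (partial_deriv a f))"

text \<open>A metric \<open>g\<close> on the coordinate space is the field of its coefficient matrices
  in the global chart: \<open>g z $ \<alpha> $ \<beta>\<close> is the component with lower indices \<open>\<alpha>\<close>, \<open>\<beta>\<close> at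
  the point \<open>z\<close>. As the domain is connected, smoothness, symmetry and nondegeneracy force the
  signature to be constant.\<close>

type_synonym 'k metric = "real ^ 'k \<Rightarrow> real ^ 'k ^ 'k"

definition pseudo_riemannian_metric :: "'k::finite metric \<Rightarrow> bool" where
  "pseudo_riemannian_metric g \<longleftrightarrow>
     (\<forall>\<alpha> \<beta> k. C_k k (\<lambda>z. g z $ \<alpha> $ \<beta>)) \<and>
     (\<forall>z. transpose (g z) = g z) \<and>
     (\<forall>z. invertible (g z))"

definition indefinite_metric :: "'k::finite metric \<Rightarrow> bool" where
  "indefinite_metric g \<longleftrightarrow>
     (\<forall>z. (\<exists>v. v \<bullet> (g z *v v) > 0) \<and> (\<exists>w. w \<bullet> (g z *v w) < 0))"

text \<open>Levi-Civita connection: \<open>christoffel g \<alpha> \<beta> \<gamma> z\<close> has upper index \<open>\<alpha>\<close> and lower indices \<open>\<beta>\<close>, \<open>\<gamma>\<close>.\<close>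

definition christoffel :: "'k::finite metric \<Rightarrow> 'k \<Rightarrow> 'k \<Rightarrow> 'k \<Rightarrow> real ^ 'k \<Rightarrow> real" where
  "christoffel g \<alpha> \<beta> \<gamma> z = 1/2 * (\<Sum>\<delta>\<in>UNIV. matrix_inv (g z) $ \<alpha> $ \<delta> *
     (partial_deriv \<beta> (\<lambda>y. g y $ \<delta> $ \<gamma>) z +
      partial_deriv \<gamma> (\<lambda>y. g y $ \<delta> $ \<beta>) z -
      partial_deriv \<delta> (\<lambda>y. g y $ \<beta> $ \<gamma>) z))"

definition ricci :: "'k::finite metric \<Rightarrow> real ^ 'k \<Rightarrow> real ^ 'k ^ 'k" where
  "ricci g z = (\<chi> \<alpha> \<beta>.
     (\<Sum>\<mu>\<in>UNIV. partial_deriv \<mu> (christoffel g \<mu> \<beta> \<alpha>) z)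
   - (\<Sum>\<mu>\<in>UNIV. partial_deriv \<beta> (christoffel g \<mu> \<mu> \<alpha>) z)
   + (\<Sum>\<mu>\<in>UNIV. \<Sum>\<gamma>\<in>UNIV. christoffel g \<mu> \<mu> \<gamma> z * christoffel g \<gamma> \<beta> \<alpha> z)
   - (\<Sum>\<mu>\<in>UNIV. \<Sum>\<gamma>\<in>UNIV. christoffel g \<mu> \<beta> \<gamma> z * christoffel g \<gamma> \<mu> \<alpha> z))"

definition scalar_curvature :: "'k::finite metric \<Rightarrow> real ^ 'k \<Rightarrow> real" where
  "scalar_curvature g z =
     (\<Sum>\<alpha>\<in>UNIV. \<Sum>\<beta>\<in>UNIV. matrix_inv (g z) $ \<alpha> $ \<beta> * ricci g z $ \<alpha> $ \<beta>)"

definition einstein_metric :: "'k::finite metric \<Rightarrow> bool" where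
  "einstein_metric g \<longleftrightarrow>
     pseudo_riemannian_metric g \<and> (\<exists>c::real. \<forall>z. ricci g z = c *\<^sub>R g z)"

text \<open>For an index type \<open>'m\<close> with \<open>n + 1\<close> elements, the coordinate indices of the
  \<open>(2n + 2)\<close>-dimensional space are \<open>'m + 'm\<close>: the coordinate \<open>p\<^sub>i\<close> of \<open>z\<close> is \<open>z $ Inl i\<close> and
  \<open>x\<^sup>i\<close> is \<open>z $ Inr i\<close>.\<close>

definition G_tilde :: "('m::finite + 'm) metric" where
  "G_tilde z = (\<chi> \<alpha> \<beta>. case (\<alpha>, \<beta>) of
       (Inl i, Inl j) \<Rightarrow> 0
     | (Inl i, Inr j) \<Rightarrow> (if i = j then 1 else 0)
     | (Inr i, Inl j) \<Rightarrow> (if i = j then 1 else 0)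
     | (Inr i, Inr j) \<Rightarrow> z $ Inl i * z $ Inl j)"

end

theory Submission imports Defs begin

text \<open>With \<open>N = n + 1\<close> and the inverse metric \<open>G\<^sup>p\<^sup>p = (- p\<^sub>i p\<^sub>j)\<close>, \<open>G\<^sup>p\<^sup>x = I\<close>, \<open>G\<^sup>x\<^sup>x = 0\<close>, the
  Christoffel symbols are polynomials of degree at most three in \<open>p\<close>, and the trace
  \<open>\<Gamma>\<^sup>\<mu>\<^sub>\<mu>\<^sub>\<alpha>\<close> vanishes, because \<open>det G\<close> is constant. So only the divergence of \<open>\<Gamma>\<close> and one
  quadratic term contribute to the Ricci tensor. In the \<open>p x\<close> block the divergence is
  \<open>(N + 1) / 2 \<cdot> \<delta>\<close> and the quadratic term is zero; in the \<open>x x\<close> block they are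
  \<open>(N + 2) p\<^sub>i p\<^sub>j\<close> and \<open>(N + 3) / 2 \<cdot> p\<^sub>i p\<^sub>j\<close>. Hence \<open>Ric = (N + 1) / 2 \<cdot> G\<close>, whose trace is
  \<open>N (N + 1)\<close>. The metric takes both signs on the vectors \<open>s \<partial>\<^sub>p + \<partial>\<^sub>x\<close>, where it is
  affine in \<open>s\<close>.\<close>

lemma sum_UNIV_Plus:
  fixes f :: "'a::finite + 'b::finite \<Rightarrow> 'c::comm_monoid_add"
  shows "(\<Sum>x\<in>UNIV. f x) = (\<Sum>i\<in>UNIV. f (Inl i)) + (\<Sum>j\<in>UNIV. f (Inr j))"
  by (simp add: UNIV_Plus_UNIV [symmetric] sum.Plus del: UNIV_Plus_UNIV)

lemma partial_derivI:
  assumes "((\<lambda>t. f (z + t *\<^sub>R axis a 1)) has_real_derivative D) (at 0)"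
  shows "partial_deriv a f z = D"
  using assms unfolding partial_deriv_def by (rule DERIV_imp_deriv)

lemma axis_one_nth: "axis a (1::real) $ i = of_bool (i = a)"
  by (simp add: axis_def)

lemma partial_deriv_const: "partial_deriv a (\<lambda>z. c) = (\<lambda>z. 0)"
  by (intro ext partial_derivI) simp

text \<open>This two-term shape covers both the first derivatives of a product of coordinates and
  the Christoffel symbols of degree one in \<open>p\<close>.\<close>

lemma partial_deriv_linear:
  "partial_deriv a (\<lambda>z. c * z $ i + d * z $ j) = (\<lambda>z. c * of_bool (i = a) + d * of_bool (j = a))"
  by (intro ext partial_derivI) (auto intro!: derivative_eq_intros simp: axis_one_nth)

lemma partial_deriv_mult_nth:
  "partial_deriv a (\<lambda>z. z $ i * z $ j) = (\<lambda>z. of_bool (j = a) * z $ i + of_bool (i = a) * z $ j)"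
  by (intro ext partial_derivI) (auto intro!: derivative_eq_intros simp: axis_one_nth)

lemma partial_deriv_mult3_nth:
  "partial_deriv a (\<lambda>z. z $ i * z $ j * z $ k) =
     (\<lambda>z. of_bool (i = a) * z $ j * z $ k + of_bool (j = a) * z $ i * z $ k + of_bool (k = a) * z $ i * z $ j)"
  by (intro ext partial_derivI) (auto intro!: derivative_eq_intros simp: axis_one_nth algebra_simps)

lemma differentiable_nth: "(\<lambda>z. z $ i) differentiable at z"
  by (rule bounded_linear_imp_differentiable) (rule bounded_linear_vec_nth)

lemma C_k_const: "C_k k (\<lambda>z. c)"
  by (induction k arbitrary: c) (simp_all add: partial_deriv_const)

text \<open>A case split on the order suffices, since the first partial derivatives are
  constants.\<close>

lemma C_k_linear: "C_k k (\<lambda>z. c * z $ i + d * z $ j)"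
  by (cases k) (auto intro!: continuous_intros derivative_intros differentiable_nth C_k_const
      simp: partial_deriv_linear)

lemma C_k_mult_nth: "C_k k (\<lambda>z. z $ i * z $ j)"
proof (cases k)
  case 0
  then show ?thesis by (auto intro!: continuous_intros)
next
  case (Suc m)
  then show ?thesis
    using C_k_linear
    by (simp only: C_k.simps partial_deriv_mult_nth) (intro conjI allI differentiable_mult differentiable_nth)
qed

lemma G_tilde_nth:
  "G_tilde z $ Inl i $ Inl j = 0"
  "G_tilde z $ Inl i $ Inr j = of_bool (i = j)"
  "G_tilde z $ Inr i $ Inl j = of_bool (i = j)"
  "G_tilde z $ Inr i $ Inr j = z $ Inl i * z $ Inl j"
  by (simp_all add: G_tilde_def)

definition G_tilde_inv :: "('m::finite + 'm) metric" where
  "G_tilde_inv z = (\<chi> \<alpha> \<beta>. case (\<alpha>, \<beta>) of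
       (Inl i, Inl j) \<Rightarrow> - (z $ Inl i * z $ Inl j)
     | (Inl i, Inr j) \<Rightarrow> of_bool (i = j)
     | (Inr i, Inl j) \<Rightarrow> of_bool (i = j)
     | (Inr i, Inr j) \<Rightarrow> 0)"

lemma G_tilde_inv_nth:
  "G_tilde_inv z $ Inl i $ Inl j = - (z $ Inl i * z $ Inl j)"
  "G_tilde_inv z $ Inl i $ Inr j = of_bool (i = j)"
  "G_tilde_inv z $ Inr i $ Inl j = of_bool (i = j)"
  "G_tilde_inv z $ Inr i $ Inr j = 0"
  by (simp_all add: G_tilde_inv_def)

lemma sum_of_bool_mult:
  fixes f :: "'a::finite \<Rightarrow> real"
  shows "(\<Sum>j\<in>UNIV. of_bool (i = j) * f j) = f i" "(\<Sum>j\<in>UNIV. of_bool (j = i) * f j) = f i"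
    "(\<Sum>j\<in>UNIV. f j * of_bool (i = j)) = f i" "(\<Sum>j\<in>UNIV. f j * of_bool (j = i)) = f i"
  by (simp_all add: of_bool_def if_distrib if_distribR cong: if_cong)

text \<open>Contraction with a Kronecker delta between two factors, as it arises when products of
  Christoffel symbols are expanded and reassociated.\<close>

lemma sum_mult_of_bool_mult:
  fixes f g :: "'a::finite \<Rightarrow> real"
  shows "(\<Sum>j\<in>UNIV. g j * (of_bool (i = j) * f j)) = g i * f i"
    "(\<Sum>j\<in>UNIV. g j * (of_bool (j = i) * f j)) = g i * f i"
  by (simp_all add: of_bool_def if_distrib if_distribR cong: if_cong)

lemma G_tilde_mult_inv: "G_tilde z ** G_tilde_inv z = mat 1"
proof -
  have "(G_tilde z ** G_tilde_inv z) $ \<alpha> $ \<beta> = mat 1 $ \<alpha> $ \<beta>" for \<alpha> \<beta>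
    by (cases \<alpha>; cases \<beta>)
      (simp_all add: matrix_matrix_mult_def mat_def sum_UNIV_Plus G_tilde_nth G_tilde_inv_nth
        sum_of_bool_mult sum_negf)
  then show ?thesis by (simp add: vec_eq_iff)
qed

lemma G_tilde_inv_mult: "G_tilde_inv z ** G_tilde z = mat 1"
  using G_tilde_mult_inv matrix_left_right_inverse by blast

text \<open>\<open>matrix_inv\<close> is a choice among two-sided inverses: the explicit inverse
  shows that one exists, and uniqueness identifies it with the chosen one.\<close>

lemma matrix_inv_G_tilde: "matrix_inv (G_tilde z) = G_tilde_inv z"
proof -
  have "G_tilde z ** matrix_inv (G_tilde z) = mat 1"
    unfolding matrix_inv_def
    by (rule someI2 [where a = "G_tilde_inv z"]) (auto simp: G_tilde_mult_inv G_tilde_inv_mult)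
  then show ?thesis
    by (metis G_tilde_inv_mult matrix_mul_assoc matrix_mul_lid matrix_mul_rid)
qed

lemma pseudo_riemannian_metric_G_tilde: "pseudo_riemannian_metric (G_tilde :: ('m::finite + 'm) metric)"
  unfolding pseudo_riemannian_metric_def
proof (intro conjI allI)
  show "C_k k (\<lambda>z. (G_tilde :: ('m + 'm) metric) z $ \<alpha> $ \<beta>)" for \<alpha> \<beta> :: "'m + 'm" and k
    by (cases \<alpha>; cases \<beta>) (auto simp: G_tilde_nth intro: C_k_const C_k_mult_nth)
  show "transpose (G_tilde z) = G_tilde z" for z :: "real ^ ('m + 'm)"
  proof -
    have "transpose (G_tilde z) $ \<alpha> $ \<beta> = G_tilde z $ \<alpha> $ \<beta>" for \<alpha> \<beta>
      by (cases \<alpha>; cases \<beta>) (auto simp: transpose_def G_tilde_nth)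
    then show ?thesis by (simp add: vec_eq_iff)
  qed
  show "invertible (G_tilde z)" for z :: "real ^ ('m + 'm)"
    using G_tilde_mult_inv G_tilde_inv_mult unfolding invertible_def by blast
qed

lemma partial_deriv_G_tilde:
  "partial_deriv (Inr k) (\<lambda>y. G_tilde y $ \<alpha> $ \<beta>) z = 0"
  "partial_deriv (Inl k) (\<lambda>y. G_tilde y $ Inl i $ \<beta>) z = 0"
  "partial_deriv (Inl k) (\<lambda>y. G_tilde y $ \<alpha> $ Inl j) z = 0"
  "partial_deriv (Inl k) (\<lambda>y. G_tilde y $ Inr i $ Inr j) z =
     of_bool (j = k) * z $ Inl i + of_bool (i = k) * z $ Inl j"
  by (cases \<alpha>; cases \<beta>; simp add: G_tilde_nth partial_deriv_const partial_deriv_mult_nth)+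

text \<open>With upper index \<open>x\<close> only -1/2 times a \<open>p\<close>-derivative of the
  metric survives, hence two lower \<open>x\<close> indices are required. The cubic symbol comes
  from the \<open>p p\<close> block of the inverse. The right-hand sides are shaped to match the
  rules for \<open>partial_deriv\<close>.\<close>

lemma christoffel_G_tilde:
  "christoffel G_tilde (Inl a) (Inl i) (Inl j) = (\<lambda>z. 0)"
  "christoffel G_tilde (Inl a) (Inl i) (Inr j) =
     (\<lambda>z. (of_bool (a = i) / 2) * z $ Inl j + (of_bool (i = j) / 2) * z $ Inl a)"
  "christoffel G_tilde (Inl a) (Inr i) (Inl j) =
     (\<lambda>z. (of_bool (a = j) / 2) * z $ Inl i + (of_bool (i = j) / 2) * z $ Inl a)"
  "christoffel G_tilde (Inl a) (Inr i) (Inr j) = (\<lambda>z. z $ Inl a * z $ Inl i * z $ Inl j)"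
  "christoffel G_tilde (Inr a) (Inl i) \<beta> = (\<lambda>z. 0)"
  "christoffel G_tilde (Inr a) \<alpha> (Inl j) = (\<lambda>z. 0)"
  "christoffel G_tilde (Inr a) (Inr i) (Inr j) =
     (\<lambda>z. (- of_bool (a = i) / 2) * z $ Inl j + (- of_bool (a = j) / 2) * z $ Inl i)"
  by (cases \<alpha>; cases \<beta>; auto simp: fun_eq_iff christoffel_def matrix_inv_G_tilde G_tilde_inv_nth
      partial_deriv_G_tilde sum_UNIV_Plus sum_of_bool_mult algebra_simps sum.distrib sum_negf
      sum_subtractf; simp flip: sum_distrib_left mult.assoc add: sum_of_bool_mult)+

lemma partial_deriv_christoffel_G_tilde:
  "partial_deriv c (christoffel G_tilde (Inl a) (Inl i) (Inl j)) = (\<lambda>z. 0)"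
  "partial_deriv c (christoffel G_tilde (Inl a) (Inl i) (Inr j)) =
     (\<lambda>z. (of_bool (a = i) / 2) * of_bool (Inl j = c) + (of_bool (i = j) / 2) * of_bool (Inl a = c))"
  "partial_deriv c (christoffel G_tilde (Inl a) (Inr i) (Inl j)) =
     (\<lambda>z. (of_bool (a = j) / 2) * of_bool (Inl i = c) + (of_bool (i = j) / 2) * of_bool (Inl a = c))"
  "partial_deriv c (christoffel G_tilde (Inl a) (Inr i) (Inr j)) =
     (\<lambda>z. of_bool (Inl a = c) * z $ Inl i * z $ Inl j + of_bool (Inl i = c) * z $ Inl a * z $ Inl j
        + of_bool (Inl j = c) * z $ Inl a * z $ Inl i)"
  "partial_deriv c (christoffel G_tilde (Inr a) (Inl i) \<beta>) = (\<lambda>z. 0)"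
  "partial_deriv c (christoffel G_tilde (Inr a) \<alpha> (Inl j)) = (\<lambda>z. 0)"
  "partial_deriv c (christoffel G_tilde (Inr a) (Inr i) (Inr j)) =
     (\<lambda>z. (- of_bool (a = i) / 2) * of_bool (Inl j = c) + (- of_bool (a = j) / 2) * of_bool (Inl i = c))"
  by (simp_all only: christoffel_G_tilde partial_deriv_const partial_deriv_linear partial_deriv_mult3_nth)

text \<open>For a lower index \<open>x\<close> the \<open>p\<close> and \<open>x\<close> halves of
  the sum are opposite; for a lower index \<open>p\<close> every summand is zero.\<close>

lemma christoffel_G_tilde_trace:
  "(\<Sum>\<mu>\<in>UNIV. christoffel G_tilde \<mu> \<mu> \<alpha> z) = 0"
  by (cases \<alpha>)
    (simp_all add: sum_UNIV_Plus christoffel_G_tilde sum.distrib sum_negf sum_subtractf sum_of_bool_mult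
      flip: sum_divide_distrib)

lemma ricci_G_tilde_nth:
  fixes z :: "real ^ ('m::finite + 'm)"
  shows "ricci G_tilde z $ \<alpha> $ \<beta> = (real CARD('m) + 1) / 2 * G_tilde z $ \<alpha> $ \<beta>"
proof -
  let ?\<Gamma> = "christoffel (G_tilde :: ('m + 'm) metric)"
  let ?N = "real CARD('m)"
  have A: "(\<Sum>\<mu>\<in>UNIV. partial_deriv \<beta> (?\<Gamma> \<mu> \<mu> \<alpha>) z) = 0"
    by (cases \<alpha>)
      (simp_all add: sum_UNIV_Plus partial_deriv_christoffel_G_tilde sum.distrib sum_negf sum_subtractf
        sum_of_bool_mult flip: sum_divide_distrib)
  have B: "(\<Sum>\<mu>\<in>UNIV. \<Sum>\<gamma>\<in>UNIV. ?\<Gamma> \<mu> \<mu> \<gamma> z * ?\<Gamma> \<gamma> \<beta> \<alpha> z) = 0"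
    \<comment> \<open>With \<open>\<gamma>\<close> outermost, the trace of the first symbol factors
      out.\<close>
    by (subst sum.swap) (simp add: christoffel_G_tilde_trace flip: sum_distrib_right)
  \<comment> \<open>The dimension enters through the sum of the derivatives of \<open>p\<close> by
    itself; the other summands of the product rule add 1 or 2.\<close>
  have C: "(\<Sum>\<mu>\<in>UNIV. partial_deriv \<mu> (?\<Gamma> \<mu> \<beta> \<alpha>) z) =
      (case (\<alpha>, \<beta>) of (Inl i, Inl j) \<Rightarrow> 0
        | (Inr i, Inr j) \<Rightarrow> (?N + 2) * z $ Inl i * z $ Inl j
        | _ \<Rightarrow> (?N + 1) / 2 * G_tilde z $ \<alpha> $ \<beta>)"
    by (cases \<alpha>; cases \<beta>)
      (simp_all add: sum_UNIV_Plus partial_deriv_christoffel_G_tilde G_tilde_nth sum.distrib sum_of_bool_mult mult.assoc field_simps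
        flip: sum_divide_distrib sum_distrib_left)
  \<comment> \<open>In the \<open>x x\<close> block, the terms with both summation indices
    \<open>p\<close> and those with both \<open>x\<close> give \<open>(?N + 3) / 4\<close> each;
    mixed terms vanish.\<close>
  have D: "(\<Sum>\<mu>\<in>UNIV. \<Sum>\<gamma>\<in>UNIV. ?\<Gamma> \<mu> \<beta> \<gamma> z * ?\<Gamma> \<gamma> \<mu> \<alpha> z) =
      (case (\<alpha>, \<beta>) of (Inr i, Inr j) \<Rightarrow> (?N + 3) / 2 * z $ Inl i * z $ Inl j | _ \<Rightarrow> 0)"
    by (cases \<alpha>; cases \<beta>)
      (simp_all add: sum_UNIV_Plus christoffel_G_tilde distrib_left distrib_right left_diff_distrib right_diff_distrib mult.assoc
        sum.distrib sum_negf sum_subtractf sum_of_bool_mult sum_mult_of_bool_mult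
        flip: sum_divide_distrib sum_distrib_left,
        simp add: field_simps)
  show ?thesis
    \<comment> \<open>In the \<open>x x\<close> block,
      \<open>(?N + 2) - (?N + 3) / 2 = (?N + 1) / 2\<close>.\<close>
    unfolding ricci_def using A B C D
    by (simp add: G_tilde_nth field_simps split: sum.splits)
qed

lemma ricci_G_tilde:
  fixes z :: "real ^ ('m::finite + 'm)"
  shows "ricci G_tilde z = ((real CARD('m) + 1) / 2) *\<^sub>R G_tilde z"
  by (simp add: vec_eq_iff ricci_G_tilde_nth)

lemma indefinite_metric_G_tilde: "indefinite_metric (G_tilde :: ('m::finite + 'm) metric)"
  unfolding indefinite_metric_def
proof (intro allI)
  fix z :: "real ^ ('m + 'm)"
  obtain k :: 'm where True by simp
  define v :: "real \<Rightarrow> real ^ ('m + 'm)"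
    where "v s = s *\<^sub>R axis (Inl k) 1 + axis (Inr k) 1" for s
  have v_nth: "v s $ Inl i = s * of_bool (i = k)" "v s $ Inr i = of_bool (i = k)" for s i
    by (auto simp: v_def axis_def)
  have "v s \<bullet> (G_tilde z *v v s) = 2 * s + (z $ Inl k)\<^sup>2" for s
    by (simp add: inner_vec_def matrix_vector_mult_def sum_UNIV_Plus G_tilde_nth v_nth sum_of_bool_mult
        power2_eq_square)
  \<comment> \<open>The parameters are \<open>s = 1\<close> and
    \<open>s = - 1 - (z $ Inl k)\<^sup>2\<close>; the latter gives the value
    \<open>- 2 - (z $ Inl k)\<^sup>2\<close>.\<close>
  moreover have "2 * 1 + (z $ Inl k)\<^sup>2 > 0" "2 * (- 1 - (z $ Inl k)\<^sup>2) + (z $ Inl k)\<^sup>2 < 0"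
    by (smt (verit) zero_le_power2)+
  ultimately show "(\<exists>v. v \<bullet> (G_tilde z *v v) > 0) \<and> (\<exists>w. w \<bullet> (G_tilde z *v w) < 0)" by metis
qed

text \<open>Contracting the metric with its inverse gives the dimension, twice
  \<open>CARD('m)\<close>, which multiplies the Einstein constant.\<close>

lemma scalar_curvature_G_tilde:
  fixes z :: "real ^ ('m::finite + 'm)"
  shows "scalar_curvature G_tilde z = real CARD('m) * (real CARD('m) + 1)"
  by (simp add: scalar_curvature_def matrix_inv_G_tilde ricci_G_tilde_nth sum_UNIV_Plus G_tilde_nth
      G_tilde_inv_nth sum_of_bool_mult flip: sum_divide_distrib)

theorem proposition6:
  fixes n :: nat
  assumes "n \<ge> 1" and "CARD('m::finite) = n + 1"
  shows "indefinite_metric (G_tilde :: ('m + 'm) metric) \<and>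
         einstein_metric (G_tilde :: ('m + 'm) metric) \<and>
         (\<forall>z. scalar_curvature (G_tilde :: ('m + 'm) metric) z = (real n + 1) * (real n + 2))"
proof (intro conjI allI)
  show "indefinite_metric (G_tilde :: ('m + 'm) metric)"
    by (rule indefinite_metric_G_tilde)
  show "einstein_metric (G_tilde :: ('m + 'm) metric)"
    unfolding einstein_metric_def using pseudo_riemannian_metric_G_tilde ricci_G_tilde by blast
  show "scalar_curvature (G_tilde :: ('m + 'm) metric) z = (real n + 1) * (real n + 2)" for z
    using assms(2) by (simp add: scalar_curvature_G_tilde algebra_simps)
qed

end
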